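(* Let $\mathcal{F}$ be a (projective, geometrically irreducible) plane curve defined over a field $K$ with at least two branches defined over $K$. Then $\mathcal{F}$ has a plane model over $K$ (that is, there is a plane curve $\mathcal{F}'$ defined over $K$ and birationally equivalent to $\mathcal{F}$ over $K$), of some degree $d'$, which has at least two singularities $P_1'$ and $P_2'$ defined over $K$, with multiplicities $r_1'$ and $r_2'$ respectively, such that $r_1'+r_2'=d'$.
   Context: Branches of $\mathcal{F}$ correspond to points of a non-singular model of $\mathcal{F}$; a branch is defined over $K$ (is $K$-rational) if the corresponding point is $K$-rational. A singularity is a point of multiplicity at least $2$ on the curve. *)

theory Defs
  imports
    "HOL-Library.Poly_Mapping"
    "HOL-Computational_Algebra.Fraction_Field"
    "HOL-Analysis.Finite_Cartesian_Product"
    "HOL-Algebra.QuotRing"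
    "HOL-Algebra.Ring_Divisibility"
    "HOL-Algebra.Algebraic_Closure_Type"
begin

section \<open>Polynomials in three homogeneous coordinates\<close>

type_synonym 'k poly3 = "(3 \<Rightarrow>\<^sub>0 nat) \<Rightarrow>\<^sub>0 'k"

definition cst :: "'k::zero \<Rightarrow> 'k poly3"
  where "cst c = Poly_Mapping.single 0 c"

definition var :: "3 \<Rightarrow> 'k::zero_neq_one poly3"
  where "var i = Poly_Mapping.single (Poly_Mapping.single i 1) 1"

definition total_deg :: "(3 \<Rightarrow>\<^sub>0 nat) \<Rightarrow> nat"
  where "total_deg m = (\<Sum>i\<in>UNIV. Poly_Mapping.lookup m i)"

text \<open>The zero polynomial is homogeneous of every degree.\<close>
definition homogeneous :: "nat \<Rightarrow> 'k::zero poly3 \<Rightarrow> bool"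
  where "homogeneous d F \<longleftrightarrow> (\<forall>m\<in>Poly_Mapping.keys F. total_deg m = d)"

definition substitute :: "(3 \<Rightarrow> 'k poly3) \<Rightarrow> 'k::field poly3 \<Rightarrow> 'k poly3"
  where "substitute G F = (\<Sum>m\<in>Poly_Mapping.keys F.
           cst (Poly_Mapping.lookup F m) * (\<Prod>i\<in>UNIV. G i ^ Poly_Mapping.lookup m i))"


section \<open>Plane curves, multiplicities and singularities\<close>

text \<open>A projective plane curve of degree \<open>d\<close> over the field \<open>'k\<close> is given by a form of
  degree \<open>d\<close> with coefficients in \<open>'k\<close>; geometric irreducibility is irreducibility
  over the algebraic closure of \<open>'k\<close>.\<close>
definition plane_curve :: "nat \<Rightarrow> 'k::field poly3 \<Rightarrow> bool"
  where "plane_curve d F \<longleftrightarrow>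
           homogeneous d F \<and> Factorial_Ring.irreducible (Poly_Mapping.map to_ac F)"

text \<open>Points of the projective plane over \<open>'k\<close> are represented by nonzero vectors of
  homogeneous coordinates.\<close>
definition same_point :: "'k::field ^ 3 \<Rightarrow> 'k ^ 3 \<Rightarrow> bool"
  where "same_point P Q \<longleftrightarrow> (\<exists>c. c \<noteq> 0 \<and> Q = c *s P)"

text \<open>The local equation at a point: dehomogenise with respect to a nonvanishing coordinate
  and translate the point to the origin of that affine chart. The remaining two variables
  are the affine coordinates.\<close>
definition local_equation :: "'k::field poly3 \<Rightarrow> 'k ^ 3 \<Rightarrow> 3 \<Rightarrow> 'k poly3"
  where "local_equation F P i =
           substitute (\<lambda>j. if j = i then 1 else var j + cst (P $ j / P $ i)) F"

text \<open>The multiplicity is the degree of the lowest homogeneous part of the local equation;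
  it does not depend on the choice of the chart.\<close>
definition multiplicity_at :: "'k::field poly3 \<Rightarrow> 'k ^ 3 \<Rightarrow> nat"
  where "multiplicity_at F P =
           Min (total_deg ` Poly_Mapping.keys (local_equation F P (SOME i. P $ i \<noteq> 0)))"

definition singular_point :: "'k::field poly3 \<Rightarrow> 'k ^ 3 \<Rightarrow> bool"
  where "singular_point F P \<longleftrightarrow> P \<noteq> 0 \<and> multiplicity_at F P \<ge> 2"


section \<open>Birational equivalence over the ground field\<close>

text \<open>A rational map over \<open>'k\<close> from the curve \<open>F\<close> to the curve \<open>F'\<close>, given by three forms of
  the same degree that do not all vanish identically on \<open>F\<close>.\<close>
definition rational_map :: "'k::field poly3 \<Rightarrow> 'k poly3 \<Rightarrow> (3 \<Rightarrow> 'k poly3) \<Rightarrow> bool"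
  where "rational_map F F' G \<longleftrightarrow>
           (\<exists>n. \<forall>i. homogeneous n (G i)) \<and> (\<exists>i. \<not> F dvd G i) \<and> F dvd substitute G F'"

text \<open>The composite of \<open>G\<close> (defined on \<open>F\<close>) followed by \<open>H\<close> is defined as a rational map on \<open>F\<close>
  and equals the identity of \<open>F\<close>.\<close>
definition composite_is_identity ::
    "'k::field poly3 \<Rightarrow> (3 \<Rightarrow> 'k poly3) \<Rightarrow> (3 \<Rightarrow> 'k poly3) \<Rightarrow> bool"
  where "composite_is_identity F G H \<longleftrightarrow>
           (\<exists>i. \<not> F dvd substitute G (H i)) \<and>
           (\<forall>i j. F dvd (var i * substitute G (H j) - var j * substitute G (H i)))"

definition birationally_equivalent :: "'k::field poly3 \<Rightarrow> 'k poly3 \<Rightarrow> bool"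
  where "birationally_equivalent F F' \<longleftrightarrow>
           (\<exists>G H. rational_map F F' G \<and> rational_map F' F H \<and>
                  composite_is_identity F G H \<and> composite_is_identity F' H G)"


section \<open>The function field and the branches of a curve\<close>

text \<open>The function field of the curve \<open>F\<close> is the residue field of the local ring of the
  projective plane at the generic point of \<open>F\<close>: quotients of forms of equal degree with
  denominator not divisible by \<open>F\<close>, modulo those with numerator divisible by \<open>F\<close>.\<close>
definition generic_ring_set :: "'k::field poly3 \<Rightarrow> 'k poly3 fract set"
  where "generic_ring_set F =
           {Fract G H | G H. (\<exists>n. homogeneous n G \<and> homogeneous n H) \<and> \<not> F dvd H}"

definition generic_ideal :: "'k::field poly3 \<Rightarrow> 'k poly3 fract set"
  where "generic_ideal F =
           {Fract G H | G H. (\<exists>n. homogeneous n G \<and> homogeneous n H) \<and> \<not> F dvd H \<and> F dvd G}"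

definition generic_ring :: "'k::field poly3 \<Rightarrow> 'k poly3 fract ring"
  where "generic_ring F =
           \<lparr>carrier = generic_ring_set F, monoid.mult = (*), one = 1, ring.zero = 0, add = (+)\<rparr>"

definition function_field :: "'k::field poly3 \<Rightarrow> 'k poly3 fract set ring"
  where "function_field F = generic_ring F Quot generic_ideal F"

definition constant_function :: "'k::field poly3 \<Rightarrow> 'k \<Rightarrow> 'k poly3 fract set"
  where "constant_function F c = generic_ideal F +>\<^bsub>generic_ring F\<^esub> Fract (cst c) 1"

definition discrete_valuation_ring :: "('a, 'b) ring_scheme \<Rightarrow> bool"
  where "discrete_valuation_ring R \<longleftrightarrow>
           principal_domain R \<and> \<not> Ring.field R \<and> (\<exists>!M. maximalideal M R)"

text \<open>The points of the nonsingular model of \<open>F\<close> correspond to their local rings, which are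
  the discrete valuation rings of the function field that contain the constants and have
  the whole function field as their field of fractions.\<close>
definition branch :: "'k::field poly3 \<Rightarrow> 'k poly3 fract set set \<Rightarrow> bool"
  where "branch F V \<longleftrightarrow>
           subring V (function_field F) \<and>
           range (constant_function F) \<subseteq> V \<and>
           discrete_valuation_ring (function_field F \<lparr>carrier := V\<rparr>) \<and>
           (\<forall>z\<in>carrier (function_field F). \<exists>a\<in>V. \<exists>b\<in>V.
              b \<noteq> \<zero>\<^bsub>function_field F\<^esub> \<and> z \<otimes>\<^bsub>function_field F\<^esub> b = a)"

text \<open>A point is rational over \<open>'k\<close> if its residue field is \<open>'k\<close>, that is, if every
  residue class is the class of a constant.\<close>
definition rational_branch :: "'k::field poly3 \<Rightarrow> 'k poly3 fract set set \<Rightarrow> bool"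
  where "rational_branch F V \<longleftrightarrow>
           branch F V \<and>
           (\<forall>M. maximalideal M (function_field F \<lparr>carrier := V\<rparr>) \<longrightarrow>
              carrier (function_field F \<lparr>carrier := V\<rparr> Quot M) =
              range (\<lambda>c. M +>\<^bsub>function_field F \<lparr>carrier := V\<rparr>\<^esub> constant_function F c))"

end

theory Submission
  imports Defs
begin

text \<open>
  Suppose that a plane curve has the affine equation \<open>f(u, v) = 0\<close>, where \<open>f\<close> has degree
  \<open>A\<close> in \<open>u\<close> and \<open>B\<close> in \<open>v\<close> and contains the term \<open>u^A v^B\<close>; that is, the
  closure of the curve in the product of two projective lines misses the point at infinity of both. Then the
  degree of the plane curve is \<open>A + B\<close>, and its multiplicities at the points at infinity of the
  two axes are \<open>B\<close> and \<open>A\<close>. Both points have coordinates in the ground field. It is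
  therefore enough to find a model over the ground field of this shape with \<open>A\<close> and
  \<open>B\<close> at least 2.

  The term \<open>u^A v^B\<close> occurs exactly if the two exponents are maximal at the same vertex of the
  Newton polygon. A monomial substitution of determinant 1 achieves this for any
  polynomial: after \<open>x = u v\<close>, \<open>y = u^N v^(N+1)\<close> the exponents of a term
  \<open>x^i y^j\<close> are \<open>i + N j\<close> and \<open>i + (N + 1) j\<close>, and for large \<open>N\<close> both
  functionals are maximal at the term with the largest \<open>j\<close>, and with the largest \<open>i\<close> among
  these (\<open>strict_transform_two_multiplicities\<close>). Large \<open>N\<close> also makes \<open>A\<close> and
  \<open>B\<close> large. Over a small finite field a curve may pass through every rational point, so
  that there is no point to move to infinity; a monomial substitution works over every field.

  Such a substitution is a Cremona transformation that restricts to an automorphism of the torus.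
  So it preserves irreducibility, over the algebraic closure as well
  (\<open>strict_transform_irreducible\<close>), and is birational on the curve
  (\<open>strict_transform_birational\<close>), as long as the curve is not a coordinate line. Coordinate
  lines are first moved by a shear (\<open>linear_change_to_no_var_factor\<close>).
\<close>

abbreviation "lookup \<equiv> Poly_Mapping.lookup"
abbreviation "keys \<equiv> Poly_Mapping.keys"
abbreviation "single \<equiv> Poly_Mapping.single"

section \<open>Substitution as a ring homomorphism\<close>

lemma poly_mapping_sum_terms:
  fixes A :: "'m \<Rightarrow>\<^sub>0 'a::comm_monoid_add"
  shows "A = (\<Sum>m\<in>keys A. single m (lookup A m))"
proof (rule poly_mapping_eqI)
  fix k
  have "lookup (\<Sum>m\<in>keys A. single m (lookup A m)) k
      = (\<Sum>m\<in>keys A. if m = k then lookup A m else 0)"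
    by (simp add: lookup_sum lookup_single when_def)
  also have "\<dots> = lookup A k"
    by (auto simp: in_keys_iff)
  finally show "lookup A k = lookup (\<Sum>m\<in>keys A. single m (lookup A m)) k" by simp
qed

lemma poly_mapping_term_induct [case_names single add]:
  fixes A :: "'m \<Rightarrow>\<^sub>0 'a::comm_monoid_add"
  assumes "\<And>m c. P (single m c)" "\<And>A B. P A \<Longrightarrow> P B \<Longrightarrow> P (A + B)"
  shows "P A"
proof -
  have "finite S \<Longrightarrow> P (\<Sum>m\<in>S. single m (lookup A m))" for S
  proof (induction S rule: finite_induct)
    case empty
    show ?case using assms(1)[of undefined 0] by simp
  qed (auto intro: assms)
  then show ?thesis
    by (metis finite_keys poly_mapping_sum_terms)
qed

text \<open>All maps from polynomials used below (substitution, grading, extension of scalars) are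
  additive by construction, so that multiplicativity only has to be seen on single terms, where
  it is a law of exponents.\<close>
lemma multiplicative_if_multiplicative_on_terms:
  fixes h :: "('m::comm_monoid_add \<Rightarrow>\<^sub>0 'k::comm_semiring_0) \<Rightarrow> 'r::comm_semiring_0"
  assumes add: "\<And>A B. h (A + B) = h A + h B"
    and terms: "\<And>m c n d. h (single m c * single n d) = h (single m c) * h (single n d)"
  shows "h (A * B) = h A * h B"
proof (induction A rule: poly_mapping_term_induct)
  case (single m c)
  show ?case
    by (induction B rule: poly_mapping_term_induct) (simp_all add: terms add distrib_left)
qed (simp add: add distrib_right)

lemma cst_0 [simp]: "cst 0 = 0"
  and cst_1 [simp]: "cst 1 = 1"
  and cst_add: "cst (a + b) = cst a + cst b"
  and cst_mult: "cst (c * d) = cst c * cst d"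
  by (simp_all add: cst_def single_add mult_single)

lemma substitute_single:
  "substitute G (single m c) = cst c * (\<Prod>i\<in>UNIV. G i ^ lookup m i)"
  by (cases "c = 0") (simp_all add: substitute_def)

lemma substitute_add: "substitute G (A + B) = substitute G A + substitute G B"
  unfolding substitute_def
  by (rule setsum_keys_plus_distrib) (simp_all add: cst_add distrib_right)

lemma substitute_mult: "substitute G (A * B) = substitute G A * substitute G B"
  by (rule multiplicative_if_multiplicative_on_terms[OF substitute_add])
     (simp add: mult_single substitute_single cst_mult lookup_add power_add prod.distrib mult_ac)

lemma substitute_0 [simp]: "substitute G 0 = 0"
  by (simp add: substitute_def)

lemma substitute_1 [simp]: "substitute G 1 = 1"
  using substitute_single[of G 0 1] by simp

lemma substitute_cst [simp]: "substitute G (cst c) = cst c"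
  by (simp add: cst_def[of c] substitute_single)

lemma substitute_var [simp]: "substitute G (var i) = G i"
proof -
  have "G j ^ (Suc 0 when i = j) = (if i = j then G j else 1)" for j
    by (simp add: when_def)
  then show ?thesis
    by (simp add: var_def substitute_single lookup_single)
qed

lemma substitute_diff: "substitute G (A - B) = substitute G A - substitute G B"
  by (metis add_diff_cancel diff_add_cancel substitute_add)

lemma substitute_sum: "substitute G (sum f S) = (\<Sum>x\<in>S. substitute G (f x))"
  by (induction S rule: infinite_finite_induct) (simp_all add: substitute_add)

lemma substitute_prod: "substitute G (prod f S) = (\<Prod>x\<in>S. substitute G (f x))"
  by (induction S rule: infinite_finite_induct) (simp_all add: substitute_mult)

lemma substitute_power: "substitute G (A ^ n) = substitute G A ^ n"
  by (induction n) (simp_all add: substitute_mult)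

lemma substitute_dvd: "A dvd B \<Longrightarrow> substitute G A dvd substitute G B"
  by (auto simp: dvd_def substitute_mult)

lemma substitute_substitute:
  "substitute G (substitute H A) = substitute (\<lambda>i. substitute G (H i)) A"
  by (simp add: substitute_def[of H] substitute_def[of "\<lambda>i. substitute G (H i)"]
      substitute_sum substitute_mult substitute_prod substitute_power)

lemma single_eq_cst_times_vars: "single m c = cst c * (\<Prod>i\<in>UNIV. var i ^ lookup m i)"
proof -
  have *: "var i ^ n = single (single i n) 1" for i :: 3 and n
    by (induction n) (simp_all add: var_def mult_single single_add[symmetric])
  have "(\<Prod>i\<in>S. single (single i (lookup m i)) 1) = single (\<Sum>i\<in>S. single i (lookup m i)) (1::'a)"
    if "finite S" for S
    using that by (induction S rule: finite_induct) (simp_all add: mult_single)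
  moreover have "(\<Sum>i\<in>UNIV. single i (lookup m i)) = m"
    by (rule poly_mapping_eqI) (simp add: lookup_sum lookup_single when_def)
  ultimately show ?thesis
    by (simp add: * cst_def mult_single)
qed

lemma substitute_id [simp]: "substitute var A = A"
  by (induction A rule: poly_mapping_term_induct)
     (simp_all add: substitute_add substitute_single single_eq_cst_times_vars[symmetric])

section \<open>Homogeneous polynomials\<close>

lemma total_deg_add: "total_deg (m + n) = total_deg m + total_deg n"
  by (simp add: total_deg_def lookup_add sum.distrib)

lemma homogeneous_0 [simp]: "homogeneous d 0"
  by (simp add: homogeneous_def)

lemma homogeneous_cst [simp]: "homogeneous 0 (cst c)"
  by (simp add: homogeneous_def cst_def total_deg_def)

lemma homogeneous_1 [simp]: "homogeneous 0 1"
  by (simp add: homogeneous_def total_deg_def)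

lemma homogeneous_var [simp]: "homogeneous 1 (var i)"
  by (simp add: homogeneous_def var_def total_deg_def lookup_single when_def)

lemma homogeneous_add: "homogeneous d A \<Longrightarrow> homogeneous d B \<Longrightarrow> homogeneous d (A + B)"
  using keys_add[of A B] by (auto simp: homogeneous_def)

lemma homogeneous_diff:
  "homogeneous d A \<Longrightarrow> homogeneous d B \<Longrightarrow> homogeneous d (A - B :: 'k::field poly3)"
  by (auto simp: homogeneous_def in_keys_iff lookup_minus)

lemma homogeneous_sum: "(\<And>x. x \<in> S \<Longrightarrow> homogeneous d (f x)) \<Longrightarrow> homogeneous d (sum f S)"
  by (induction S rule: infinite_finite_induct) (simp_all add: homogeneous_add)

lemma homogeneous_mult: "homogeneous d A \<Longrightarrow> homogeneous e B \<Longrightarrow> homogeneous (d + e) (A * B)"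
  using keys_mult[of A B] by (fastforce simp: homogeneous_def total_deg_add)

lemma homogeneous_power: "homogeneous d A \<Longrightarrow> homogeneous (n * d) (A ^ n)"
  by (induction n) (simp_all add: homogeneous_mult)

lemma homogeneous_prod:
  "finite S \<Longrightarrow> (\<And>x. x \<in> S \<Longrightarrow> homogeneous (e x) (f x)) \<Longrightarrow> homogeneous (sum e S) (prod f S)"
  by (induction S rule: finite_induct) (simp_all add: homogeneous_mult)

lemma homogeneous_substitute:
  assumes "\<And>i. homogeneous n (G i)" "homogeneous d A"
  shows "homogeneous (n * d) (substitute G A)"
  unfolding substitute_def
proof (rule homogeneous_sum)
  fix m assume m: "m \<in> keys A"
  have "homogeneous (0 + (\<Sum>i\<in>UNIV. lookup m i * n))
          (cst (lookup A m) * (\<Prod>i\<in>UNIV. G i ^ lookup m i))"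
    by (intro homogeneous_mult homogeneous_cst homogeneous_prod homogeneous_power assms) simp
  moreover have "(\<Sum>i\<in>UNIV. lookup m i * n) = n * d"
    using assms(2) m by (simp add: homogeneous_def total_deg_def mult.commute sum_distrib_left[symmetric])
  ultimately show "homogeneous (n * d) (cst (lookup A m) * (\<Prod>i\<in>UNIV. G i ^ lookup m i))"
    by simp
qed

text \<open>Rescaling all homogeneous coordinates by a common factor, which may itself be a polynomial,
  multiplies a form by a power of that factor; this is why a Cremona transformation and its
  inverse compose to the identity up to a factor.\<close>
lemma substitute_scaled_vars:
  assumes "homogeneous d A"
  shows "substitute (\<lambda>i. C * G i) A = C ^ d * substitute G A"
proof -
  have "(\<Prod>i\<in>UNIV. (C * G i) ^ lookup m i) = C ^ d * (\<Prod>i\<in>UNIV. G i ^ lookup m i)"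
    if "m \<in> keys A" for m
    using that assms
    by (simp add: power_mult_distrib prod.distrib homogeneous_def total_deg_def power_sum[symmetric])
  then show ?thesis
    by (simp add: substitute_def sum_distrib_left mult_ac)
qed

text \<open>A form of positive degree vanishes wherever all its arguments do, since every one of its terms
  contains at least one of them.\<close>
lemma dvd_substitute_of_dvd_all:
  assumes "homogeneous d A" "d > 0" "\<And>i. D dvd G i"
  shows "D dvd substitute G A"
  unfolding substitute_def
proof (rule dvd_sum)
  fix m assume "m \<in> keys A"
  then have "(\<Sum>i\<in>UNIV. lookup m i) \<noteq> 0"
    using assms(1,2) by (simp add: homogeneous_def total_deg_def)
  then obtain i where i: "lookup m i > 0"
    by auto
  have "D dvd G i ^ lookup m i"
    using i by (intro dvd_trans[OF assms(3) dvd_power]) simp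
  also have "\<dots> dvd (\<Prod>i\<in>UNIV. G i ^ lookup m i)"
    by (rule dvd_prodI) auto
  finally show "D dvd cst (lookup A m) * (\<Prod>i\<in>UNIV. G i ^ lookup m i)"
    by simp
qed

text \<open>This is the polynomial \<open>A(t x, t y, t z)\<close> in a new variable \<open>t\<close>. It turns homogeneity
  into a statement about a univariate polynomial over a domain.\<close>
definition graded :: "'k::field poly3 \<Rightarrow> 'k poly3 poly"
  where "graded A = (\<Sum>m\<in>keys A. monom (single m (lookup A m)) (total_deg m))"

lemma graded_single: "graded (single m c) = monom (single m c) (total_deg m)"
  by (cases "c = 0") (simp_all add: graded_def)

lemma graded_add: "graded (A + B) = graded A + graded B"
  unfolding graded_def
  by (rule setsum_keys_plus_distrib) (simp_all add: single_add add_monom)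

lemma graded_mult: "graded (A * B) = graded A * graded B"
  by (rule multiplicative_if_multiplicative_on_terms[OF graded_add])
     (simp add: mult_single graded_single mult_monom total_deg_add)

lemma lookup_coeff_graded:
  "lookup (coeff (graded A) n) m = (if total_deg m = n then lookup A m else 0)"
proof (induction A rule: poly_mapping_term_induct)
  case (single k c)
  show ?case by (auto simp: graded_single lookup_single when_def)
next
  case (add A B)
  then show ?case by (simp add: graded_add lookup_add)
qed

lemma homogeneous_iff_graded: "homogeneous d A \<longleftrightarrow> graded A = monom A d"
proof
  assume "homogeneous d A"
  then have "graded A = (\<Sum>m\<in>keys A. monom (single m (lookup A m)) d)"
    by (simp add: graded_def homogeneous_def)
  also have "\<dots> = monom (\<Sum>m\<in>keys A. single m (lookup A m)) d"
    by (rule poly_eqI) (simp add: coeff_sum)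
  finally show "graded A = monom A d"
    by (simp add: poly_mapping_sum_terms[symmetric])
next
  assume g: "graded A = monom A d"
  show "homogeneous d A"
    unfolding homogeneous_def
  proof
    fix m assume m: "m \<in> keys A"
    have "lookup (coeff (graded A) (total_deg m)) m = lookup A m"
      by (simp add: lookup_coeff_graded)
    then show "total_deg m = d"
      using m unfolding g by (auto simp: in_keys_iff split: if_splits)
  qed
qed

lemma monom_of_order_eq_degree:
  fixes p :: "'a::idom poly"
  assumes "p \<noteq> 0" "order 0 p = degree p"
  shows "\<exists>c. p = monom c (degree p)"
proof -
  obtain q where q: "p = [:-0, 1:] ^ order 0 p * q"
    using order_1 dvdE by blast
  then have "q \<noteq> 0" using assms by auto
  then have "degree p = order 0 p + degree q"
    by (subst q) (simp add: degree_mult_eq degree_power_eq)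
  then have "degree q = 0" using assms by simp
  then obtain c where c: "q = [:c:]" by (metis degree_eq_zeroE)
  have "p = smult c ([:0, 1:] ^ degree p)"
    using q assms(2) by (simp add: c)
  then have "p = monom c (degree p)"
    by (simp add: monom_altdef)
  then show ?thesis by blast
qed

text \<open>Over a domain the degree in \<open>t\<close> and the order of vanishing at \<open>t = 0\<close> are both additive, and
  the second is never larger than the first. They agree for a homogeneous product, hence for
  each factor.\<close>
lemma homogeneous_factor:
  fixes A B :: "'k::field poly3"
  assumes "homogeneous d (A * B)" "A * B \<noteq> 0"
  shows "\<exists>n. homogeneous n A"
proof -
  have eq: "graded A * graded B = monom (A * B) d"
    using assms(1) by (simp add: homogeneous_iff_graded graded_mult)
  then have nz: "graded A \<noteq> 0" "graded B \<noteq> 0"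
    using assms(2) by (auto simp: monom_eq_0_iff)
  have o: "order 0 (graded A) + order 0 (graded B) = d"
    using order_mult[of "graded A" "graded B" 0] nz assms(2) unfolding eq
    by (simp add: monom_eq_0_iff order_0_monom)
  have dg: "degree (graded A) + degree (graded B) = d"
    using degree_mult_eq[OF nz] assms(2) unfolding eq by (simp add: degree_monom_eq)
  have "order 0 (graded A) = degree (graded A)"
    using o dg order_degree[OF nz(1), of 0] order_degree[OF nz(2), of 0] by linarith
  then obtain c where c: "graded A = monom c (degree (graded A))"
    using monom_of_order_eq_degree[OF nz(1)] by blast
  show ?thesis
  proof (intro exI, unfold homogeneous_def, intro ballI)
    fix m assume m: "m \<in> keys A"
    have "lookup (coeff (graded A) (total_deg m)) m \<noteq> 0"
      using m by (simp add: lookup_coeff_graded in_keys_iff)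
    then show "total_deg m = degree (graded A)"
      by (subst (asm) c) (auto split: if_splits)
  qed
qed

section \<open>Monomials and monomial factors\<close>

text \<open>Exponent vectors are handled as plain functions, so that identities between monomials reduce
  to arithmetic of natural numbers.\<close>
definition mon :: "(3 \<Rightarrow> nat) \<Rightarrow> 'k::field poly3"
  where "mon a = single (Abs_poly_mapping a) 1"

lemma Abs_poly_mapping_add:
  fixes a b :: "3 \<Rightarrow> nat"
  shows "Abs_poly_mapping (\<lambda>i. a i + b i) = Abs_poly_mapping a + Abs_poly_mapping b"
  by (rule poly_mapping_eqI) (simp add: lookup_add)

lemma mon_0 [simp]: "mon (\<lambda>i. 0) = 1"
  by (simp add: mon_def)

lemma mon_mult: "mon a * mon b = mon (\<lambda>i. a i + b i)"
  by (simp add: mon_def mult_single Abs_poly_mapping_add)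

lemma mon_power: "mon a ^ n = mon (\<lambda>i. n * a i)"
  by (induction n) (simp_all add: mon_mult)

lemma mon_prod: "finite S \<Longrightarrow> (\<Prod>x\<in>S. mon (f x)) = mon (\<lambda>i. \<Sum>x\<in>S. f x i)"
  by (induction S rule: finite_induct) (simp_all add: mon_mult)

lemma mon_nonzero [simp]: "mon a \<noteq> 0"
  by (metis keys_single keys_zero mon_def singleton_insert_inj_eq' insert_not_empty zero_neq_one)

lemma var_eq_mon: "var i = mon (\<lambda>j. if j = i then 1 else 0)"
proof -
  have "single i 1 = Abs_poly_mapping (\<lambda>j. if j = i then 1 else (0::nat))"
    by (rule poly_mapping_eqI) (simp add: lookup_single when_def)
  then show ?thesis by (simp add: mon_def var_def)
qed

lemma homogeneous_mon: "homogeneous (\<Sum>i\<in>UNIV. a i) (mon a)"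
  by (simp add: homogeneous_def mon_def total_deg_def)

lemma substitute_mon:
  "substitute (\<lambda>j. mon (a j)) (mon f) = mon (\<lambda>i. \<Sum>j\<in>UNIV. f j * a j i)"
  by (simp add: mon_def[of f] substitute_single mon_power mon_prod)

lemma lookup_mon_times: "lookup (mon a * A) (Abs_poly_mapping a + m) = lookup A m"
  by (induction A rule: poly_mapping_term_induct)
     (simp_all add: distrib_left lookup_add mon_def mult_single lookup_single)

lemma keys_mon_times: "keys (mon a * A) = (+) (Abs_poly_mapping a) ` keys A"
proof
  show "keys (mon a * A) \<subseteq> (+) (Abs_poly_mapping a) ` keys A"
    using keys_mult[of "mon a" A] by (auto simp: mon_def)
  show "(+) (Abs_poly_mapping a) ` keys A \<subseteq> keys (mon a * A)"
    by (auto simp: in_keys_iff lookup_mon_times)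
qed

lemma var_dvd_iff:
  fixes A :: "'k::field poly3"
  shows "var i dvd A \<longleftrightarrow> (\<forall>m\<in>keys A. lookup m i > 0)"
proof
  assume "var i dvd A"
  then obtain B where "A = var i * B" by (elim dvdE)
  then show "\<forall>m\<in>keys A. lookup m i > 0"
    by (auto simp: var_eq_mon keys_mon_times lookup_add)
next
  assume *: "\<forall>m\<in>keys A. lookup m i > 0"
  have "var i dvd (\<Sum>m\<in>keys A. single m (lookup A m))"
  proof (rule dvd_sum)
    fix m assume "m \<in> keys A"
    then have "var i dvd (var i :: 'k poly3) ^ lookup m i"
      using * by (intro dvd_power) simp
    also have "\<dots> dvd (\<Prod>j\<in>UNIV. var j ^ lookup m j)"
      by (rule dvd_prodI) auto
    finally show "var i dvd single m (lookup A m)"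
      by (subst single_eq_cst_times_vars) simp
  qed
  then show "var i dvd A" by (simp add: poly_mapping_sum_terms[symmetric])
qed

text \<open>The polynomials divisible by a variable form the kernel of the substitution of 0 for it.
  As this is a ring homomorphism into a domain, variables are prime.\<close>
lemma var_dvd_iff_substitute:
  fixes A :: "'k::field poly3"
  shows "var i dvd A \<longleftrightarrow> substitute (\<lambda>j. if j = i then 0 else var j) A = 0"
proof
  assume "var i dvd A"
  then obtain B where "A = var i * B" by (elim dvdE)
  then show "substitute (\<lambda>j. if j = i then 0 else var j) A = 0" by (simp add: substitute_mult)
next
  have "var i dvd A - substitute (\<lambda>j. if j = i then 0 else var j) A"
  proof (induction A rule: poly_mapping_term_induct)
    case (single m c)
    show ?case
    proof (cases "lookup m i = 0")
      case True
      have *: "(\<Prod>j\<in>UNIV. (if j = i then 0 else var j) ^ lookup m j) = (\<Prod>j\<in>UNIV. var j ^ lookup m j :: 'k poly3)"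
        by (rule prod.cong) (simp_all add: True)
      have "substitute (\<lambda>j. if j = i then 0 else var j) (single m c) = single m c"
        unfolding substitute_single * by (rule single_eq_cst_times_vars[symmetric])
      then show ?thesis by (simp only: diff_self dvd_0_right)
    next
      case False
      have "substitute (\<lambda>j. if j = i then 0 else var j) (single m c) = 0"
        using False by (auto simp: substitute_single intro!: exI[of _ i])
      moreover have "var i dvd single m c"
        using False by (cases "c = 0") (auto simp: var_dvd_iff)
      ultimately show ?thesis by simp
    qed
  next
    case (add A B)
    then show ?case
      using dvd_add[of "var i" "A - substitute (\<lambda>j. if j = i then 0 else var j) A" "B - substitute (\<lambda>j. if j = i then 0 else var j) B"]
      by (simp add: substitute_add algebra_simps)
  qed
  moreover assume "substitute (\<lambda>j. if j = i then 0 else var j) A = 0"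
  ultimately show "var i dvd A" by simp
qed

text \<open>Equivalently, the curve contains none of the three coordinate lines, on which monomial
  transformations degenerate.\<close>
definition no_var_factor :: "'k::field poly3 \<Rightarrow> bool"
  where "no_var_factor A \<longleftrightarrow> (\<forall>i. \<not> var i dvd A)"

lemma no_var_factor_iff: "no_var_factor A \<longleftrightarrow> (\<forall>i. \<exists>m\<in>keys A. lookup m i = 0)"
  by (auto simp: no_var_factor_def var_dvd_iff)

lemma no_var_factor_mult: "no_var_factor A \<Longrightarrow> no_var_factor B \<Longrightarrow> no_var_factor (A * B)"
  by (simp add: no_var_factor_def var_dvd_iff_substitute substitute_mult)

lemma no_var_factor_dvd: "no_var_factor A \<Longrightarrow> B dvd A \<Longrightarrow> no_var_factor B"
  by (meson dvd_trans no_var_factor_def)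

text \<open>Every nonzero polynomial splits into a monomial and a part prime to all variables. Dividing out
  a variable lowers the degree of any chosen term, so the process stops.\<close>
lemma monomial_content:
  fixes A :: "'k::field poly3"
  assumes "A \<noteq> 0"
  obtains a B where "A = mon a * B" "no_var_factor B"
proof -
  have "\<exists>a B. A = mon a * B \<and> no_var_factor B" if "m \<in> keys A" for A :: "'k poly3" and m
    using that
  proof (induction "total_deg m" arbitrary: A m rule: less_induct)
    case less
    show ?case
    proof (cases "no_var_factor A")
      case True
      then show ?thesis by (intro exI[of _ "\<lambda>i. 0"] exI[of _ A]) simp
    next
      case False
      then obtain i B where AB: "A = var i * B"
        by (auto simp: no_var_factor_def elim: dvdE)
      with less(2) obtain n where n: "n \<in> keys B"
        and m: "m = Abs_poly_mapping (\<lambda>j. if j = i then 1 else 0) + n"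
        by (auto simp: var_eq_mon keys_mon_times)
      have "total_deg n < total_deg m"
        by (simp add: m total_deg_add) (simp add: total_deg_def)
      from less(1)[OF this n] obtain a D where "B = mon a * D" "no_var_factor D"
        by blast
      then have "A = mon (\<lambda>j. (if j = i then 1 else 0) + a j) * D"
        by (simp only: AB var_eq_mon mon_mult[symmetric] mult.assoc)
      with \<open>no_var_factor D\<close> show ?thesis by blast
    qed
  qed
  moreover obtain m where "m \<in> keys A"
    using assms by fastforce
  ultimately show ?thesis using that by blast
qed

text \<open>For each variable, the exponent in the monomial is the least exponent with which the variable
  occurs in the product.\<close>
lemma monomial_content_unique:
  assumes eq: "mon a * A = mon b * B" and "no_var_factor A" "no_var_factor B"
  shows "A = B"
proof -
  have le: "a i \<le> b i" if eq: "mon a * A = mon b * B" and B: "no_var_factor B" for a b A and B :: "'k::field poly3" and i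
  proof -
    obtain m where m: "m \<in> keys B" "lookup m i = 0"
      using B by (auto simp: no_var_factor_iff)
    then have "Abs_poly_mapping b + m \<in> keys (mon a * A)"
      unfolding eq by (simp add: keys_mon_times)
    then obtain n where "Abs_poly_mapping b + m = Abs_poly_mapping a + n"
      by (auto simp: keys_mon_times)
    from arg_cong[OF this, of "\<lambda>k. lookup k i"] m(2) show ?thesis
      by (simp add: lookup_add)
  qed
  have "a = b"
    using le[OF eq assms(3)] le[OF eq[symmetric] assms(2)] by (auto intro!: ext antisym)
  then show ?thesis using eq by simp
qed

text \<open>Monomials are units on the torus, and a polynomial without variable factors is determined there:
  divisibility on the torus is divisibility.\<close>
lemma dvd_mon_times_cancel:
  assumes A: "no_var_factor A" and dvd: "A dvd mon a * B"
  shows "A dvd B"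
proof (cases "B = 0")
  case False
  obtain Q where Q: "mon a * B = A * Q" using dvd by (elim dvdE)
  then have "Q \<noteq> 0" using False by auto
  then obtain q Q1 where Q1: "Q = mon q * Q1" "no_var_factor Q1" by (rule monomial_content)
  obtain b B1 where B1: "B = mon b * B1" "no_var_factor B1" using False by (rule monomial_content)
  have "mon (\<lambda>i. a i + b i) * B1 = mon q * (A * Q1)"
    using Q by (simp add: B1(1) Q1(1) mon_mult[symmetric] mult_ac)
  then have "B1 = A * Q1"
    by (rule monomial_content_unique) (simp_all add: B1 Q1 A no_var_factor_mult)
  then show ?thesis by (simp add: B1(1))
qed simp

lemma unit_if_dvd_mon: "no_var_factor A \<Longrightarrow> A dvd mon a \<Longrightarrow> A dvd 1"
  using dvd_mon_times_cancel[of A a 1] by simp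

lemma exponent_occurs_if_not_unit:
  fixes A :: "'k::field poly3"
  assumes "A \<noteq> 0" "\<not> A dvd 1"
  obtains m i where "m \<in> keys A" "lookup m i > 0"
proof -
  have False if *: "\<And>m i. m \<in> keys A \<Longrightarrow> lookup m i = 0"
  proof -
    have "A = cst (lookup A 0)"
    proof (rule poly_mapping_eqI)
      fix k
      show "lookup A k = lookup (cst (lookup A 0)) k"
      proof (cases "k \<in> keys A")
        case True
        then have "k = 0" using * by (intro poly_mapping_eqI) simp
        then show ?thesis by (simp add: cst_def)
      next
        case False
        then show ?thesis by (auto simp: cst_def lookup_single when_def in_keys_iff)
      qed
    qed
    then obtain c where c: "A = cst c" by blast
    then have "A * cst (inverse c) = 1"
      using assms(1) by (cases "c = 0") (simp_all add: cst_mult[symmetric])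
    then show False using assms(2) by (metis dvd_triv_left)
  qed
  then show ?thesis using that by (metis gr0I)
qed

section \<open>Extension of scalars to the algebraic closure\<close>

abbreviation extend_scalars :: "'k::field poly3 \<Rightarrow> 'k alg_closure poly3"
  where "extend_scalars \<equiv> Poly_Mapping.map to_ac"

lemma lookup_extend_scalars: "lookup (extend_scalars A) m = to_ac (lookup A m)"
  by (simp add: Poly_Mapping.map.rep_eq when_def)

lemma keys_extend_scalars [simp]: "keys (extend_scalars A) = keys A"
  by (auto simp: in_keys_iff lookup_extend_scalars)

lemma extend_scalars_add: "extend_scalars (A + B) = extend_scalars A + extend_scalars B"
  by (rule poly_mapping_eqI) (simp add: lookup_extend_scalars lookup_add)

lemma extend_scalars_single: "extend_scalars (single m c) = single m (to_ac c)"
  by (rule poly_mapping_eqI) (simp add: lookup_extend_scalars lookup_single when_def)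

lemma extend_scalars_mult: "extend_scalars (A * B) = extend_scalars A * extend_scalars B"
  by (rule multiplicative_if_multiplicative_on_terms[OF extend_scalars_add])
     (simp add: mult_single extend_scalars_single)

lemma extend_scalars_0 [simp]: "extend_scalars 0 = 0"
  by (rule poly_mapping_eqI) (simp add: lookup_extend_scalars)

lemma extend_scalars_1 [simp]: "extend_scalars 1 = 1"
  using extend_scalars_single[of 0 1] by simp

lemma extend_scalars_var [simp]: "extend_scalars (var i) = var i"
  by (simp add: var_def extend_scalars_single)

lemma extend_scalars_mon [simp]: "extend_scalars (mon a) = mon a"
  by (simp add: mon_def extend_scalars_single)

lemma extend_scalars_diff: "extend_scalars (A - B) = extend_scalars A - extend_scalars B"
  by (rule poly_mapping_eqI) (simp add: lookup_extend_scalars lookup_minus)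

lemma extend_scalars_dvd: "A dvd B \<Longrightarrow> extend_scalars A dvd extend_scalars B"
  by (auto simp: dvd_def extend_scalars_mult)

lemma extend_scalars_substitute:
  "extend_scalars (substitute G A) = substitute (\<lambda>i. extend_scalars (G i)) (extend_scalars A)"
proof (induction A rule: poly_mapping_term_induct)
  case (single m c)
  have pow: "extend_scalars (P ^ n) = extend_scalars P ^ n" for P :: "'a poly3" and n
    by (induction n) (simp_all add: extend_scalars_mult)
  have "extend_scalars (\<Prod>i\<in>S. P i) = (\<Prod>i\<in>S. extend_scalars (P i))"
    if "finite S" for P :: "3 \<Rightarrow> 'a poly3" and S
    using that by (induction S rule: finite_induct) (simp_all add: extend_scalars_mult)
  then show ?case
    by (simp add: substitute_single extend_scalars_single extend_scalars_mult pow cst_def)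
qed (simp add: substitute_add extend_scalars_add)

lemma homogeneous_extend_scalars [simp]: "homogeneous d (extend_scalars A) \<longleftrightarrow> homogeneous d A"
  by (simp add: homogeneous_def)

lemma no_var_factor_extend_scalars [simp]:
  "no_var_factor (extend_scalars A) \<longleftrightarrow> no_var_factor A"
  by (simp add: no_var_factor_iff)

section \<open>Monomial Cremona transformations\<close>

text \<open>A Cremona transformation of the plane given by three monomials of degree \<open>n\<close> with exponent
  vectors \<open>a j\<close>, with the inverse given by the exponent vectors \<open>b j\<close>. The assumptions on the
  composites say that the products of the two exponent matrices are the identity up to adding one
  and the same row, a common monomial factor \<open>c\<close> or \<open>c'\<close> of the three coordinates. Such a map is an
  automorphism of the torus where all coordinates are nonzero.\<close>
locale monomial_cremona =
  fixes a b :: "3 \<Rightarrow> 3 \<Rightarrow> nat" and c c' :: "3 \<Rightarrow> nat" and n n' :: nat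
  assumes degree_a: "(\<Sum>i\<in>UNIV. a j i) = n" and degree_b: "(\<Sum>i\<in>UNIV. b j i) = n'"
    and b_after_a: "(\<Sum>k\<in>UNIV. a j k * b k i) = c i + (if i = j then 1 else 0)"
    and a_after_b: "(\<Sum>k\<in>UNIV. b j k * a k i) = c' i + (if i = j then 1 else 0)"
    and degree_pos: "n > 0" "n' > 0"
begin

text \<open>As substitutions act contravariantly, \<open>\<psi>\<close> sends the equation of a curve to that of its total
  transform under the map with exponents \<open>b\<close>, and \<open>\<phi>\<close> goes in the opposite direction.\<close>
abbreviation "\<psi> \<equiv> substitute (\<lambda>j. mon (a j))"
abbreviation "\<phi> \<equiv> substitute (\<lambda>j. mon (b j))"

text \<open>The situation is symmetric, so every statement below also holds with the two directions exchanged.\<close>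
lemma swap: "monomial_cremona b a c' c n' n"
  by (simp add: monomial_cremona_def degree_a degree_b a_after_b b_after_a degree_pos)

lemma \<phi>_mon_a: "\<phi> (mon (a j)) = mon c * var j"
  by (simp add: substitute_mon b_after_a var_eq_mon mon_mult)

lemma \<phi>_\<psi>: "homogeneous d A \<Longrightarrow> \<phi> (\<psi> A) = mon c ^ d * A"
  by (simp add: substitute_substitute \<phi>_mon_a substitute_scaled_vars[where G = var, simplified])

lemma \<psi>_nonzero:
  assumes "homogeneous d A" "A \<noteq> 0"
  shows "\<psi> A \<noteq> 0"
proof
  assume "\<psi> A = 0"
  then have "mon c ^ d * A = 0" using \<phi>_\<psi>[OF assms(1)] by simp
  with assms(2) show False by simp
qed

lemma unit_if_\<phi>_dvd_mon:
  assumes "homogeneous d A" "no_var_factor A" "\<phi> A dvd mon e"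
  shows "A dvd 1"
proof -
  have "\<psi> (\<phi> A) dvd \<psi> (mon e)"
    using assms(3) by (rule substitute_dvd)
  then have "mon c' ^ d * A dvd mon (\<lambda>i. \<Sum>j\<in>UNIV. e j * a j i)"
    by (simp add: monomial_cremona.\<phi>_\<psi>[OF swap assms(1)] substitute_mon)
  then have "A dvd mon (\<lambda>i. \<Sum>j\<in>UNIV. e j * a j i)"
    by (rule dvd_mult_right)
  then show ?thesis by (rule unit_if_dvd_mon[OF assms(2)])
qed

text \<open>The strict transform \<open>F'\<close> is what remains of the total transform of \<open>F\<close> after all variables
  are divided out. A factorisation of \<open>F'\<close> pulls back to one of \<open>F\<close> up to monomials, and since
  \<open>F\<close> has no variable factors, to a genuine one. One factor therefore becomes a monomial
  after pulling back, hence also after going forth again, and is then a unit because it has no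
  variable factors either. Homogeneity of the factors is used to recognise the result of going
  back and forth as the factor itself times a monomial.\<close>
lemma strict_transform_irreducible:
  fixes F F' :: "'k::field poly3"
  assumes F: "Factorial_Ring.irreducible F" "homogeneous d F" "no_var_factor F"
    and F': "\<psi> F = mon e * F'" "no_var_factor F'"
  shows "Factorial_Ring.irreducible F'"
proof (rule irreducibleI)
  have nz: "\<psi> F \<noteq> 0"
    using F(1) by (intro \<psi>_nonzero[OF F(2)]) auto
  show "F' \<noteq> 0" using nz F'(1) by auto
  have e: "\<phi> (mon e) = mon (\<lambda>i. \<Sum>j\<in>UNIV. e j * b j i)" (is "_ = mon ?e")
    by (rule substitute_mon)
  have pullback: "mon (\<lambda>i. d * c i) * F = mon ?e * \<phi> F'"
    using \<phi>_\<psi>[OF F(2)] unfolding F'(1) by (simp add: substitute_mult e mon_power)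
  show "\<not> F' dvd 1"
  proof
    assume "F' dvd 1"
    then have "\<psi> F dvd mon e" by (simp add: F'(1))
    then have "F dvd 1"
      using monomial_cremona.unit_if_\<phi>_dvd_mon[OF swap F(2,3)] by blast
    with F(1) show False by (auto simp: irreducible_def)
  qed
  fix g h assume gh: "F' = g * h"
  have hom: "homogeneous (n * d) (\<psi> F)"
    by (rule homogeneous_substitute[OF _ F(2)]) (metis degree_a homogeneous_mon)
  obtain k where "homogeneous k g"
    using homogeneous_factor[of "n * d" g "mon e * h"] hom nz by (auto simp: F'(1) gh mult_ac)
  obtain l where "homogeneous l h"
    using homogeneous_factor[of "n * d" h "mon e * g"] hom nz by (auto simp: F'(1) gh mult_ac)
  have "\<phi> F' \<noteq> 0" using pullback F(1) by auto
  then have "\<phi> g \<noteq> 0" "\<phi> h \<noteq> 0" by (auto simp: gh substitute_mult)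
  obtain u g1 where g1: "\<phi> g = mon u * g1" "no_var_factor g1"
    using \<open>\<phi> g \<noteq> 0\<close> by (rule monomial_content)
  obtain v h1 where h1: "\<phi> h = mon v * h1" "no_var_factor h1"
    using \<open>\<phi> h \<noteq> 0\<close> by (rule monomial_content)
  have "mon (\<lambda>i. d * c i) * F = mon (\<lambda>i. ?e i + (u i + v i)) * (g1 * h1)"
    using pullback by (simp add: gh substitute_mult g1(1) h1(1) mon_mult[symmetric] mult_ac)
  then have "F = g1 * h1"
    by (rule monomial_content_unique) (simp_all add: F g1 h1 no_var_factor_mult)
  then consider "g1 dvd 1" | "h1 dvd 1"
    using irreducibleD[OF F(1)] by blast
  then show "g dvd 1 \<or> h dvd 1"
  proof cases
    case 1
    then have "\<phi> g dvd mon u" by (simp add: g1)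
    then have "g dvd 1"
      using no_var_factor_dvd[OF F'(2), of g]
      by (intro unit_if_\<phi>_dvd_mon[OF \<open>homogeneous k g\<close>]) (auto simp: gh)
    then show ?thesis ..
  next
    case 2
    then have "\<phi> h dvd mon v" by (simp add: h1)
    then have "h dvd 1"
      using no_var_factor_dvd[OF F'(2), of h]
      by (intro unit_if_\<phi>_dvd_mon[OF \<open>homogeneous l h\<close>]) (auto simp: gh)
    then show ?thesis ..
  qed
qed

end

section \<open>Birational equivalence\<close>

text \<open>If two triples of forms are inverse to each other as maps of the whole plane, up to common
  factors \<open>C\<close> and \<open>C'\<close>, then the identities required of the composites hold
  identically and not only modulo the curves. It remains to know that the common factors do not vanish on the curves.\<close>
lemma birationally_equivalent_if_inverse_forms:
  fixes F F' :: "'k::field poly3"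
  assumes G: "\<And>i. homogeneous n' (G i)" "n' > 0" and H: "\<And>i. homogeneous n (H i)" "n > 0"
    and GH: "\<And>j. substitute G (H j) = C * var j"
    and HG: "\<And>j. substitute H (G j) = C' * var j"
    and dvd: "F dvd substitute G F'" "F' dvd substitute H F"
    and defined: "\<exists>j. \<not> F dvd C * var j" "\<exists>j. \<not> F' dvd C' * var j"
  shows "birationally_equivalent F F'"
proof -
  have "\<exists>i. \<not> F dvd G i"
    using dvd_substitute_of_dvd_all[OF H, of F G] defined(1) by (auto simp: GH)
  moreover have "\<exists>i. \<not> F' dvd H i"
    using dvd_substitute_of_dvd_all[OF G, of F' H] defined(2) by (auto simp: HG)
  moreover have "var i * (D * var j) - var j * (D * var i) = 0" for D :: "'k poly3" and i j
    by (simp add: mult_ac)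
  ultimately show ?thesis
    unfolding birationally_equivalent_def rational_map_def composite_is_identity_def
    using G H dvd defined GH HG
    by (intro exI[of _ G] exI[of _ H]) (auto simp: GH HG)
qed

definition inverse_linear_forms :: "(3 \<Rightarrow> 'k::field poly3) \<Rightarrow> (3 \<Rightarrow> 'k poly3) \<Rightarrow> bool"
  where "inverse_linear_forms L L' \<longleftrightarrow>
    (\<forall>j. homogeneous 1 (L j) \<and> homogeneous 1 (L' j) \<and>
         substitute L (L' j) = var j \<and> substitute L' (L j) = var j)"

lemma substitute_inverse_linear_forms:
  assumes "inverse_linear_forms L L'"
  shows "substitute L (substitute L' A) = A" "substitute L' (substitute L A) = A"
  using assms by (simp_all add: inverse_linear_forms_def substitute_substitute)

lemma irreducible_linear_change:
  fixes A :: "'k::field poly3"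
  assumes L: "inverse_linear_forms L L'" and A: "Factorial_Ring.irreducible A"
  shows "Factorial_Ring.irreducible (substitute L A)"
proof (rule irreducibleI)
  note inv = substitute_inverse_linear_forms[OF L]
  show "substitute L A \<noteq> 0"
    using inv(2)[of A] A by auto
  show "\<not> substitute L A dvd 1"
    using substitute_dvd[of "substitute L A" 1 L'] A by (auto simp: inv irreducible_def)
  fix g h assume "substitute L A = g * h"
  then have "A = substitute L' g * substitute L' h"
    by (metis inv(2) substitute_mult)
  then have "substitute L' g dvd 1 \<or> substitute L' h dvd 1"
    using A by (auto simp: irreducible_def)
  then show "g dvd 1 \<or> h dvd 1"
    using substitute_dvd[of "substitute L' g" 1 L] substitute_dvd[of "substitute L' h" 1 L]
    by (auto simp: inv)
qed

lemma inverse_linear_forms_id: "inverse_linear_forms var var"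
  using homogeneous_var by (auto simp: inverse_linear_forms_def)

lemma inverse_linear_forms_shear:
  assumes "p \<noteq> i"
  shows "inverse_linear_forms (\<lambda>j. if j = i then var i - var p else var j :: 'k::field poly3)
           (\<lambda>j. if j = i then var i + var p else var j)"
  using assms
  by (auto simp: inverse_linear_forms_def substitute_add substitute_diff
      simp del: One_nat_def intro!: homogeneous_add homogeneous_diff homogeneous_var)

lemma lookup_var: "lookup (var i :: 'k::field poly3) m = (if m = single i 1 then 1 else 0)"
  by (simp add: var_def lookup_single when_def)

text \<open>The two terms are coprime.\<close>
lemma no_var_factor_shear:
  assumes "p \<noteq> i"
  shows "no_var_factor (var i - var p :: 'k::field poly3)"
  unfolding no_var_factor_def
proof (intro allI notI)
  fix j assume "var j dvd (var i - var p :: 'k poly3)"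
  moreover have ne: "single i 1 \<noteq> (single p 1 :: 3 \<Rightarrow>\<^sub>0 nat)"
    using assms by (metis lookup_single_eq lookup_single_not_eq zero_neq_one)
  then have "single i 1 \<in> keys (var i - var p :: 'k poly3)"
    "single p 1 \<in> keys (var i - var p :: 'k poly3)"
    by (auto simp: in_keys_iff lookup_minus lookup_var)
  ultimately have "lookup (single i 1) j > (0::nat)" "lookup (single p 1) j > (0::nat)"
    by (auto simp: var_dvd_iff)
  then show False
    using assms by (auto simp: lookup_single when_def split: if_splits)
qed

text \<open>An irreducible form with a variable factor is that variable up to a constant, so the curve is a
  coordinate line. A shear moves it to a line which is not a coordinate line. All other
  curves can stay where they are.\<close>
lemma linear_change_to_no_var_factor:
  fixes F :: "'k::field poly3"
  assumes "plane_curve d F"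
  obtains L L' where "inverse_linear_forms L L'" "plane_curve d (substitute L F)"
    "no_var_factor (substitute L F)"
proof -
  have hom: "homogeneous d F" and irr: "Factorial_Ring.irreducible (extend_scalars F)"
    using assms by (auto simp: plane_curve_def)
  have curve: "plane_curve d (substitute L F)"
    if L: "inverse_linear_forms L L'"
      "inverse_linear_forms (\<lambda>j. extend_scalars (L j)) (\<lambda>j. extend_scalars (L' j))" for L L'
    using homogeneous_substitute[of 1 L d F] L(1) hom irreducible_linear_change[OF L(2) irr]
    by (auto simp: plane_curve_def extend_scalars_substitute inverse_linear_forms_def)
  show ?thesis
  proof (cases "no_var_factor F")
    case True
    have "plane_curve d (substitute var F)" using assms by simp
    then show ?thesis using that[OF inverse_linear_forms_id] True by simp
  next
    case False
    then obtain i G where F: "F = var i * G" by (auto simp: no_var_factor_def elim: dvdE)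
    obtain p :: 3 where p: "p \<noteq> i" by (metis one_neq_zero)
    let ?L = "\<lambda>j. if j = i then var i - var p else (var j :: 'k poly3)"
    let ?L' = "\<lambda>j. if j = i then var i + var p else (var j :: 'k poly3)"
    have c: "plane_curve d (substitute ?L F)"
    proof (rule curve)
      show "inverse_linear_forms ?L ?L'"
        by (rule inverse_linear_forms_shear[OF p])
      show "inverse_linear_forms (\<lambda>j. extend_scalars (?L j)) (\<lambda>j. extend_scalars (?L' j))"
        using inverse_linear_forms_shear[OF p, where 'k = "'k alg_closure"]
        by (simp only: if_distrib[of extend_scalars] extend_scalars_add extend_scalars_diff
            extend_scalars_var)
    qed
    have "\<not> (var i :: 'k alg_closure poly3) dvd 1"
      using var_dvd_iff[of i 1] by simp
    then have unit: "extend_scalars G dvd 1"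
      using irr by (auto simp: irreducible_def F extend_scalars_mult)
    have "no_var_factor (extend_scalars (substitute ?L F))"
    proof -
      have "extend_scalars (substitute ?L F)
          = (var i - var p) * extend_scalars (substitute ?L G)"
        by (simp add: F substitute_mult extend_scalars_mult extend_scalars_diff)
      moreover have "extend_scalars (substitute ?L G) dvd 1"
        using substitute_dvd[OF unit, of "\<lambda>i. extend_scalars (?L i)"]
        by (simp add: extend_scalars_substitute)
      ultimately have "extend_scalars (substitute ?L F) dvd var i - var p"
        using mult_dvd_mono[OF dvd_refl, of _ 1 "var i - var p :: 'k alg_closure poly3"]
        by (simp only: mult_1_right)
      then show ?thesis using no_var_factor_shear[OF p] no_var_factor_dvd by blast
    qed
    then have "no_var_factor (substitute ?L F)"
      by (simp only: no_var_factor_extend_scalars)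
    then show ?thesis by (rule that[OF inverse_linear_forms_shear[OF p] c])
  qed
qed

text \<open>The birational map is the monomial transformation after the linear change of coordinates. The
  common factors that arise are monomials in the respective coordinates, and neither curve contains a
  coordinate line.\<close>
lemma (in monomial_cremona) strict_transform_birational:
  fixes F F' :: "'k::field poly3"
  assumes L: "inverse_linear_forms L L'" and F: "homogeneous d (substitute L F)"
      "no_var_factor (substitute L F)" "\<not> substitute L F dvd 1"
    and F': "\<psi> (substitute L F) = mon e * F'" "no_var_factor F'" "\<not> F' dvd 1"
  shows "birationally_equivalent F F'"
proof -
  define G where "G j = substitute L' (mon (b j))" for j
  define H where "H j = \<psi> (L j)" for j
  note inv = substitute_inverse_linear_forms[OF L]
  have lin: "homogeneous 1 (L j)" "homogeneous 1 (L' j)" "substitute L (L' j) = var j"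
    "substitute L' (L j) = var j" for j
    using L by (auto simp: inverse_linear_forms_def)
  have G_eq: "substitute G A = substitute L' (\<phi> A)" for A
    by (simp add: substitute_substitute G_def[abs_def])
  have H_eq: "substitute H A = \<psi> (substitute L A)" for A
    by (simp add: substitute_substitute H_def[abs_def])
  have \<phi>\<psi>: "\<phi> (\<psi> (L j)) = mon c * L j" for j
    using \<phi>_\<psi>[OF lin(1)] by simp
  show ?thesis
  proof (rule birationally_equivalent_if_inverse_forms)
    show "homogeneous (1 * n') (G i)" for i
      unfolding G_def by (rule homogeneous_substitute[OF lin(2)]) (metis degree_b homogeneous_mon)
    show "homogeneous (n * 1) (H i)" for i
      unfolding H_def by (rule homogeneous_substitute[OF _ lin(1)]) (metis degree_a homogeneous_mon)
    show "1 * n' > 0" "n * 1 > 0" using degree_pos by auto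
    show "substitute G (H j) = substitute L' (mon c) * var j" for j
      by (simp add: G_eq H_def \<phi>\<psi> substitute_mult lin)
    show "substitute H (G j) = mon c' * var j" for j
      by (simp add: H_eq G_def inv monomial_cremona.\<phi>_mon_a[OF swap])
    have "\<phi> (mon e) * \<phi> F' = mon c ^ d * substitute L F"
      using \<phi>_\<psi>[OF F(1)] by (simp add: F' substitute_mult)
    then have "substitute L F dvd mon (\<lambda>i. \<Sum>j\<in>UNIV. e j * b j i) * \<phi> F'"
      by (simp add: substitute_mon)
    then have "substitute L F dvd \<phi> F'"
      by (rule dvd_mon_times_cancel[OF F(2)])
    then show "F dvd substitute G F'"
      using substitute_dvd[of _ _ L'] by (fastforce simp: G_eq inv)
    show "F' dvd substitute H F"
      by (simp add: H_eq F')
    show "\<exists>j. \<not> F' dvd mon c' * var j"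
      using unit_if_dvd_mon[OF F'(2)] F'(3) by (auto simp: var_eq_mon mon_mult)
    show "\<exists>j. \<not> F dvd substitute L' (mon c) * var j"
    proof (rule ccontr)
      assume "\<nexists>j. \<not> F dvd substitute L' (mon c) * var j"
      then have "substitute L F dvd mon c * L j" for j
        using substitute_dvd[of F "substitute L' (mon c) * var j" L]
        by (simp add: substitute_mult inv)
      then have "substitute L F dvd L j" for j
        using dvd_mon_times_cancel[OF F(2)] by blast
      then have "substitute L F dvd substitute L (L' j)" for j
        by (intro dvd_substitute_of_dvd_all[OF lin(2)]) simp_all
      then have "substitute L F dvd var 0"
        by (simp add: lin)
      then show False
        using unit_if_dvd_mon[OF F(2)] F(3) by (auto simp: var_eq_mon)
    qed
  qed
qed

section \<open>Multiplicities at the coordinate points\<close>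

lemma keys_relabelled_terms:
  assumes "inj_on f (keys A)"
  shows "keys (\<Sum>m\<in>keys A. single (f m) (lookup A m)) = f ` keys A"
proof -
  have lookup: "lookup (\<Sum>m\<in>keys A. single (f m) (lookup A m)) k
      = (\<Sum>m\<in>keys A. if f m = k then lookup A m else 0)" for k
    by (simp add: lookup_sum lookup_single when_def)
  have "lookup (\<Sum>m\<in>keys A. single (f m) (lookup A m)) (f n) = lookup A n" if n: "n \<in> keys A" for n
  proof -
    have "(\<Sum>m\<in>keys A. if f m = f n then lookup A m else 0)
        = (\<Sum>m\<in>keys A. if m = n then lookup A m else 0)"
      using assms n by (intro sum.cong) (auto simp: inj_on_def)
    then show ?thesis using n by (simp add: lookup)
  qed
  moreover have "lookup (\<Sum>m\<in>keys A. single (f m) (lookup A m)) k = 0" if "k \<notin> f ` keys A" for k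
    unfolding lookup using that by (intro sum.neutral) auto
  ultimately have "k \<in> keys (\<Sum>m\<in>keys A. single (f m) (lookup A m)) \<longleftrightarrow> k \<in> f ` keys A" for k
    by (cases "k \<in> f ` keys A") (auto simp: in_keys_iff)
  then show ?thesis by blast
qed

text \<open>At a coordinate point the local equation arises by setting one variable to 1. A term of a form of
  degree \<open>d\<close> in which this variable has exponent \<open>e\<close> becomes a term of degree
  \<open>d - e\<close>, and by homogeneity no two terms become proportional, so nothing cancels.\<close>
lemma multiplicity_at_coordinate_point:
  fixes F :: "'k::field poly3"
  assumes F: "homogeneous d F" and k: "k \<in> keys F"
    and max: "\<And>m. m \<in> keys F \<Longrightarrow> lookup m p \<le> lookup k p"
  shows "multiplicity_at F (axis p 1) = d - lookup k p"
proof -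
  define f where "f m = Abs_poly_mapping (\<lambda>j. if j = p then 0 else lookup m j)"
    for m :: "3 \<Rightarrow>\<^sub>0 nat"
  have total: "total_deg m = lookup m p + total_deg (f m)" for m
  proof -
    have "(\<Sum>j\<in>UNIV. if j = p then 0 else lookup m j) = (\<Sum>j\<in>UNIV - {p}. lookup m j)"
      by (rule sum.mono_neutral_cong_right) auto
    then show ?thesis
      by (simp only: total_deg_def f_def sum.remove[OF finite UNIV_I, of _ p]
          lookup_Abs_poly_mapping[OF finite])
  qed
  have deg_f: "total_deg (f m) = d - lookup m p" "lookup m p \<le> d" if "m \<in> keys F" for m
    using that F total[of m] by (auto simp: homogeneous_def)
  have inj: "inj_on f (keys F)"
  proof (rule inj_onI)
    fix m n assume mn: "m \<in> keys F" "n \<in> keys F" "f m = f n"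
    have "lookup m j = lookup n j" for j
    proof (cases "j = p")
      case True
      then show ?thesis using deg_f[OF mn(1)] deg_f[OF mn(2)] mn(3) by auto
    next
      case False
      then show ?thesis using arg_cong[OF mn(3), of "\<lambda>h. lookup h j"] by (simp add: f_def)
    qed
    then show "m = n" by (rule poly_mapping_eqI)
  qed
  \<comment> \<open>the coordinate point lies in one standard chart only\<close>
  have chart: "(SOME i. (axis p 1 :: 'k ^ 3) $ i \<noteq> 0) = p"
    by (rule some_equality) (auto simp: axis_def split: if_splits)
  have "(\<lambda>j. if j = p then 1 else var j + cst ((axis p 1 :: 'k ^ 3) $ j / (axis p 1 :: 'k ^ 3) $ p))
      = (\<lambda>j. if j = p then 1 else var j)"
    by (auto simp: axis_def)
  moreover have "cst c * (\<Prod>j\<in>UNIV. (if j = p then 1 else var j) ^ lookup m j) = single (f m) c"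
    for c :: 'k and m
    by (subst single_eq_cst_times_vars) (auto simp: f_def intro!: arg_cong2[of _ _ _ _ "(*)"] prod.cong)
  ultimately have "local_equation F (axis p 1) p = (\<Sum>m\<in>keys F. single (f m) (lookup F m))"
    by (simp add: local_equation_def substitute_def)
  then have "keys (local_equation F (axis p 1) p) = f ` keys F"
    by (simp only: keys_relabelled_terms[OF inj])
  then have "multiplicity_at F (axis p 1) = Min ((\<lambda>m. d - lookup m p) ` keys F)"
    by (simp add: multiplicity_at_def chart image_image deg_f cong: image_cong)
  also have "\<dots> = d - lookup k p"
    using k max by (intro Min_eqI) (auto intro: diff_le_mono2)
  finally show ?thesis .
qed

section \<open>A Cremona transformation with two complementary multiplicities\<close>

text \<open>With \<open>x\<close>, \<open>y\<close>, \<open>z\<close> the variables of index \<open>p\<close>, \<open>q\<close> and the third index, and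
  \<open>N = M + 1\<close>, these are the exponents of the substitution that is
  \<open>x = u v\<close>, \<open>y = u^N v^(N+1)\<close> in the chart \<open>z = 1\<close>; the exponents of the third variable bring the
  three monomials to the same degree \<open>2 M + 3\<close>. The determinant of the affine exponents is 1, so
  that the substitution is invertible, by \<open>u = x^(N+1) / y\<close>, \<open>v = y / x^N\<close>.\<close>
definition forward_exponents :: "nat \<Rightarrow> 3 \<Rightarrow> 3 \<Rightarrow> 3 \<Rightarrow> 3 \<Rightarrow> nat" where
  "forward_exponents M p q j i =
     (if j = p then (if i = p \<or> i = q then 1 else 2 * M + 1)
      else if j = q then (if i = p then M + 1 else if i = q then M + 2 else 0)
      else (if i = p \<or> i = q then 0 else 2 * M + 3))"

definition backward_exponents :: "nat \<Rightarrow> 3 \<Rightarrow> 3 \<Rightarrow> 3 \<Rightarrow> 3 \<Rightarrow> nat" where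
  "backward_exponents M p q j i =
     (if j = p then (if i = p then 2 * M + 3 else 0)
      else if j = q then (if i = p then 0 else if i = q then 2 else 2 * M + 1)
      else (if i = q then 1 else M + 1))"

lemma UNIV_3_distinct:
  fixes p q r :: 3
  assumes "distinct [p, q, r]"
  shows "(UNIV :: 3 set) = {p, q, r}"
proof -
  have "card {p, q, r} = card (UNIV :: 3 set)" using assms by simp
  then show ?thesis by (metis card_subset_eq finite subset_UNIV)
qed

lemma sum_UNIV_3_distinct:
  fixes p q r :: 3
  assumes "distinct [p, q, r]"
  shows "sum f UNIV = f p + (f q + f r)"
  using assms by (simp add: UNIV_3_distinct[OF assms] add.assoc)

lemma monomial_cremona_exponents:
  fixes p q r :: 3
  assumes "distinct [p, q, r]"
  shows "monomial_cremona (forward_exponents M p q) (backward_exponents M p q)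
    (\<lambda>i. if i = p then 2 * M * M + 5 * M + 3 else if i = q then 2 * M + 3 else 2 * M * M + 5 * M + 2)
    (\<lambda>i. if i = p then 2 * M + 2 else if i = q then 2 * M + 3 else 4 * M * M + 8 * M + 3)
    (2 * M + 3) (2 * M + 3)"
proof -
  have cases: "P p \<Longrightarrow> P q \<Longrightarrow> P r \<Longrightarrow> P j" for P and j :: 3
    using UNIV_3_distinct[OF assms] by (metis UNIV_I insertE singletonD)
  show ?thesis
  proof (unfold_locales, goal_cases)
    case (1 j)
    show ?case
      by (rule cases[where j = j])
        (use assms in \<open>auto simp: sum_UNIV_3_distinct[OF assms] forward_exponents_def\<close>)
  next
    case (2 j)
    show ?case
      by (rule cases[where j = j])
        (use assms in \<open>auto simp: sum_UNIV_3_distinct[OF assms] backward_exponents_def\<close>)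
  next
    case (3 j i)
    show ?case
      by (rule cases[where j = j]; rule cases[where j = i])
        (use assms in \<open>auto simp: sum_UNIV_3_distinct[OF assms] forward_exponents_def backward_exponents_def algebra_simps\<close>)
  next
    case (4 j i)
    show ?case
      by (rule cases[where j = j]; rule cases[where j = i])
        (use assms in \<open>auto simp: sum_UNIV_3_distinct[OF assms] forward_exponents_def backward_exponents_def algebra_simps\<close>)
  qed auto
qed

text \<open>In affine coordinates a term \<open>x^i y^j\<close> goes to \<open>u^(i + N j) v^(i + (N + 1) j)\<close>. Here
  \<open>N = d + 2\<close> exceeds every exponent \<open>i\<close>, so both new exponents order the terms first by
  \<open>j\<close> and are maximal at the same term. In the strict transform let this term be
  \<open>u^A v^B\<close>. It has the maximal total degree in \<open>u\<close> and \<open>v\<close> and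
  accordingly no factor of the third variable, which gives the degree \<open>A + B\<close>, while the
  multiplicities at the points at infinity of the two axes are \<open>A + B - A\<close> and
  \<open>A + B - B\<close>. As \<open>y\<close> occurs in some term, both exponents are at least \<open>N\<close> before
  the monomial content is removed. A term without \<open>y\<close> shows that at most \<open>d\<close> is
  removed, so both remain at least 2.\<close>
lemma strict_transform_two_multiplicities:
  fixes F F' :: "'k::field poly3"
  assumes pqr: "distinct [p, q, r]" and F: "homogeneous d F" "no_var_factor F"
    and q: "m \<in> keys F" "lookup m q > 0"
    and F': "substitute (\<lambda>j. mon (forward_exponents (d + 1) p q j)) F = mon e * F'"
      "no_var_factor F'"
  shows "\<exists>d'. homogeneous d' F' \<and> multiplicity_at F' (axis p 1) \<ge> 2 \<and>
    multiplicity_at F' (axis q 1) \<ge> 2 \<and>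
    multiplicity_at F' (axis p 1) + multiplicity_at F' (axis q 1) = d'"
proof -
  note sum3 = sum_UNIV_3_distinct[OF pqr]
  \<comment> \<open>the effect of the transformation on exponent vectors\<close>
  define f where "f m = Abs_poly_mapping
      (\<lambda>i. \<Sum>j\<in>UNIV. lookup m j * forward_exponents (d + 1) p q j i)" for m :: "3 \<Rightarrow>\<^sub>0 nat"
  have f: "lookup (f m) p = lookup m p + (d + 2) * lookup m q"
    "lookup (f m) q = lookup m p + (d + 3) * lookup m q"
    "lookup (f m) r = (2 * d + 3) * lookup m p + (2 * d + 5) * lookup m r" for m
    using pqr by (auto simp: f_def sum3 forward_exponents_def algebra_simps)
  have deg: "lookup m p + lookup m q + lookup m r = d" if "m \<in> keys F" for m
    using F(1) that by (auto simp: homogeneous_def total_deg_def sum3)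
  have deg_f: "lookup (f m) p + lookup (f m) q + lookup (f m) r = (2 * d + 5) * d" if "m \<in> keys F" for m
    unfolding f deg[OF that, symmetric] by (simp add: algebra_simps)
  have inj: "inj_on f (keys F)"
  proof (rule inj_onI)
    fix m n assume mn: "m \<in> keys F" "n \<in> keys F" "f m = f n"
    have "lookup m q = lookup n q"
      using f(1,2)[of m] f(1,2)[of n] mn(3) by (simp add: algebra_simps)
    moreover from this have "lookup m p = lookup n p"
      using f(1)[of m] f(1)[of n] mn(3) by simp
    moreover from calculation have "lookup m r = lookup n r"
      using deg[OF mn(1)] deg[OF mn(2)] by simp
    ultimately have "lookup m j = lookup n j" for j
      using UNIV_3_distinct[OF pqr] by (cases "j = p"; cases "j = q"; cases "j = r") auto
    then show "m = n" by (rule poly_mapping_eqI)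
  qed
  have "cst c * (\<Prod>j\<in>UNIV. mon (forward_exponents (d + 1) p q j) ^ lookup m j) = single (f m) c"
    for m and c :: 'k
    by (simp add: mon_power mon_prod cst_def) (simp add: mon_def mult_single f_def)
  then have "substitute (\<lambda>j. mon (forward_exponents (d + 1) p q j)) F
      = (\<Sum>m\<in>keys F. single (f m) (lookup F m))"
    by (simp only: substitute_def)
  then have "keys (mon e * F') = f ` keys F"
    by (simp only: F'(1) keys_relabelled_terms[OF inj])
  then have keys: "f ` keys F = (+) (Abs_poly_mapping e) ` keys F'"
    by (simp only: keys_mon_times)
  have to: "\<exists>k\<in>keys F'. \<forall>i. lookup (f m) i = e i + lookup k i" if "m \<in> keys F" for m
  proof -
    have "f m \<in> (+) (Abs_poly_mapping e) ` keys F'" using that keys by blast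
    then show ?thesis by (auto simp: lookup_add)
  qed
  have from': "\<exists>m\<in>keys F. \<forall>i. lookup (f m) i = e i + lookup k i" if "k \<in> keys F'" for k
  proof -
    have "Abs_poly_mapping e + k \<in> f ` keys F" using that keys by blast
    then obtain m where "m \<in> keys F" "f m = Abs_poly_mapping e + k" by auto
    then show ?thesis by (intro bexI[of _ m]) (simp_all add: lookup_add)
  qed
  have "finite ((\<lambda>m. lookup (f m) p) ` keys F)" "(\<lambda>m. lookup (f m) p) ` keys F \<noteq> {}"
    using q(1) by auto
  from Max_in[OF this] obtain n where n: "n \<in> keys F"
      "lookup (f n) p = Max ((\<lambda>m. lookup (f m) p) ` keys F)"
    by auto
  then have max_p: "lookup (f m) p \<le> lookup (f n) p" if "m \<in> keys F" for m
    using that by simp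
  \<comment> \<open>one more \<open>y\<close> outweighs any power of \<open>x\<close>, so the chosen term also has maximal exponent of \<open>y\<close>\<close>
  have n_q: "lookup m q \<le> lookup n q" if m: "m \<in> keys F" for m
  proof (rule ccontr)
    assume "\<not> lookup m q \<le> lookup n q"
    then have "lookup n q + 1 \<le> lookup m q" by simp
    then have "(d + 2) * (lookup n q + 1) \<le> (d + 2) * lookup m q"
      by (rule mult_le_mono2)
    moreover have "lookup n p \<le> d" using deg[OF n(1)] by simp
    ultimately show False
      using max_p[OF m] unfolding f by (simp add: algebra_simps)
  qed
  have max_q: "lookup (f m) q \<le> lookup (f n) q" if "m \<in> keys F" for m
    using max_p[OF that] n_q[OF that] unfolding f by (simp add: algebra_simps)
  obtain k where k: "k \<in> keys F'" "\<And>i. lookup (f n) i = e i + lookup k i"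
    using to[OF n(1)] by blast
  have k_max: "lookup l p \<le> lookup k p" "lookup l q \<le> lookup k q" if l: "l \<in> keys F'" for l
  proof -
    obtain m where "m \<in> keys F" "\<And>i. lookup (f m) i = e i + lookup l i"
      using from'[OF l] by blast
    then show "lookup l p \<le> lookup k p" "lookup l q \<le> lookup k q"
      using max_p[of m] max_q[of m] by (simp_all add: k(2))
  qed
  have k_r: "lookup k r = 0"
  proof -
    obtain l where l: "l \<in> keys F'" "lookup l r = 0"
      using F'(2) by (auto simp: no_var_factor_iff)
    obtain m where m: "m \<in> keys F" "\<And>i. lookup (f m) i = e i + lookup l i"
      using from'[OF l(1)] by blast
    have "lookup k r \<le> lookup l r"
      using deg_f[OF m(1)] deg_f[OF n(1)] k_max[OF l(1)] unfolding m(2) k(2) by simp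
    then show ?thesis using l(2) by simp
  qed
  have hom: "homogeneous (lookup k p + lookup k q) F'"
    unfolding homogeneous_def
  proof
    fix l assume "l \<in> keys F'"
    then obtain m where m: "m \<in> keys F" "\<And>i. lookup (f m) i = e i + lookup l i"
      using from' by blast
    show "total_deg l = lookup k p + lookup k q"
      using deg_f[OF m(1)] deg_f[OF n(1)] k_r unfolding m(2) k(2) total_deg_def sum3 by simp
  qed
  obtain m0 where m0: "m0 \<in> keys F" "lookup m0 q = 0"
    using F(2) by (auto simp: no_var_factor_iff)
  obtain k0 where k0: "\<And>i. lookup (f m0) i = e i + lookup k0 i"
    using to[OF m0(1)] by blast
  have "lookup n q \<ge> 1" using n_q[OF q(1)] q(2) by simp
  then have "(d + 2) * 1 \<le> (d + 2) * lookup n q" "(d + 3) * 1 \<le> (d + 3) * lookup n q"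
    by (intro mult_le_mono2; simp)+
  then have n_large: "d + 2 \<le> lookup (f n) p" "d + 2 \<le> lookup (f n) q"
    unfolding f by (simp_all add: algebra_simps)
  have "e p \<le> d" "e q \<le> d"
    using k0[of p] k0[of q] deg[OF m0(1)] m0(2) unfolding f by auto
  then have "2 \<le> lookup k p" "2 \<le> lookup k q"
    using n_large unfolding k(2) by simp_all
  moreover have "multiplicity_at F' (axis p 1) = lookup k q"
    using multiplicity_at_coordinate_point[OF hom k(1) k_max(1)] by simp
  moreover have "multiplicity_at F' (axis q 1) = lookup k p"
    using multiplicity_at_coordinate_point[OF hom k(1) k_max(2)] by simp
  ultimately show ?thesis using hom by (metis add.commute)
qed

theorem proposition5p3:
  fixes F :: "'k::field poly3" and d :: nat
  assumes "plane_curve d F"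
    and "\<exists>V W. V \<noteq> W \<and> rational_branch F V \<and> rational_branch F W"
  shows "\<exists>(F' :: 'k poly3) d' P1 P2.
           plane_curve d' F' \<and> birationally_equivalent F F' \<and>
           singular_point F' P1 \<and> singular_point F' P2 \<and> \<not> same_point P1 P2 \<and>
           multiplicity_at F' P1 + multiplicity_at F' P2 = d'"
proof -
  obtain L L' where L: "inverse_linear_forms L L'" and curve: "plane_curve d (substitute L F)"
    and nvf: "no_var_factor (substitute L F)"
    using assms(1) by (rule linear_change_to_no_var_factor)
  define F1 where "F1 = substitute L F"
  have F1: "homogeneous d F1" "no_var_factor F1" "Factorial_Ring.irreducible (extend_scalars F1)"
    using curve nvf by (auto simp: F1_def plane_curve_def)
  have not_unit: "\<not> A dvd 1" if "Factorial_Ring.irreducible (extend_scalars A)" for A :: "'k poly3"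
    using that extend_scalars_dvd[of A 1] by (auto simp: irreducible_def)
  have "F1 \<noteq> 0"
    using F1(3) by auto
  then obtain m q where q: "m \<in> keys F1" "lookup m q > 0"
    using not_unit[OF F1(3)] by (rule exponent_occurs_if_not_unit)
  have "card (UNIV - {q}) = 2" by simp
  then obtain p r where pr: "UNIV - {q} = {p, r}" "p \<noteq> r"
    by (metis card_2_iff)
  then have "p \<in> UNIV - {q}" "r \<in> UNIV - {q}" by simp_all
  with pr(2) have pqr: "distinct [p, q, r]" by simp
  define M where "M = d + 1"
  obtain c c' where
    "monomial_cremona (forward_exponents M p q) (backward_exponents M p q) c c' (2 * M + 3) (2 * M + 3)"
    using monomial_cremona_exponents[OF pqr] by blast
  then interpret C: monomial_cremona "forward_exponents M p q" "backward_exponents M p q" c c'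
    "2 * M + 3" "2 * M + 3" .
  obtain e F' where F': "C.\<psi> F1 = mon e * F'" "no_var_factor F'"
    using C.\<psi>_nonzero[OF F1(1) \<open>F1 \<noteq> 0\<close>] by (rule monomial_content)
  have "extend_scalars (C.\<psi> F1) = C.\<psi> (extend_scalars F1)"
    by (simp only: extend_scalars_substitute extend_scalars_mon)
  then have F'_ext: "C.\<psi> (extend_scalars F1) = mon e * extend_scalars F'"
    by (simp only: F'(1) extend_scalars_mult extend_scalars_mon)
  have irr: "Factorial_Ring.irreducible (extend_scalars F')"
  proof (rule C.strict_transform_irreducible[OF F1(3) _ _ F'_ext])
    show "homogeneous d (extend_scalars F1)" "no_var_factor (extend_scalars F1)"
      "no_var_factor (extend_scalars F')"
      using F1(1,2) F'(2) by simp_all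
  qed
  have bir: "birationally_equivalent F F'"
    by (rule C.strict_transform_birational[OF L F1(1,2)[unfolded F1_def]
          not_unit[OF F1(3), unfolded F1_def] F'[unfolded F1_def] not_unit[OF irr]])
  obtain d' where d': "homogeneous d' F'" "multiplicity_at F' (axis p 1) \<ge> 2"
      "multiplicity_at F' (axis q 1) \<ge> 2"
      "multiplicity_at F' (axis p 1) + multiplicity_at F' (axis q 1) = d'"
    using strict_transform_two_multiplicities[OF pqr F1(1,2) q F'[unfolded M_def]] by blast
  have "\<not> same_point (axis p 1 :: 'k ^ 3) (axis q 1)"
  proof
    assume "same_point (axis p 1 :: 'k ^ 3) (axis q 1)"
    then obtain s where s: "s \<noteq> 0" "(axis q 1 :: 'k ^ 3) = s *s axis p 1"
      by (auto simp: same_point_def)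
    from arg_cong[OF s(2), of "\<lambda>v. v $ p"] show False
      using s(1) pqr by (simp add: axis_def)
  qed
  moreover have "singular_point F' (axis p 1)" "singular_point F' (axis q 1)"
    using d' by (auto simp: singular_point_def axis_eq_0_iff)
  moreover have "plane_curve d' F'"
    using d'(1) irr by (simp add: plane_curve_def)
  ultimately show ?thesis
    using bir d'(4) by blast
qed

end
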